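(* Let $\mathcal{H}=(V,H)$ be a boolean representable simplicial complex. Then: (i) if every singleton $\{p\}$ ($p\in V$) belongs to $H$, then $V$ is the union of the atoms of the lattice of flats $\mathrm{Fl}\,\mathcal{H}$; (ii) the lattice $\mathrm{Fl}\,\mathcal{H}$ is atomistic.
   Context: A (finite) simplicial complex is a pair $\mathcal{H}=(V,H)$ where $V$ is a finite nonempty set and $H\subseteq 2^V$ is nonempty and closed under taking subsets. A subset $X\subseteq V$ is a flat if for every $I\in H$ with $I\subseteq X$ and every $p\in V\setminus X$ we have $I\cup\{p\}\in H$; the flats ordered by inclusion form a lattice $\mathrm{Fl}\,\mathcal{H}$ (meet is intersection). A set $X$ is a transversal of the successive differences for a chain of subsets $A_0\subset A_1\subset\cdots\subset A_k$ if $X$ admits an enumeration $x_1,\dots,x_k$ (distinct elements) with $x_i\in A_i\setminus A_{i-1}$ for $i=1,\dots,k$. $\mathcal{H}$ is boolean representable if every $X\in H$ is a transversal of the successive differences for some chain in $\mathrm{Fl}\,\mathcal{H}$. An atom of a lattice is an element covering the bottom element; a finite lattice is atomistic if every element is a join of atoms (the bottom being the empty join). *)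

theory Defs
  imports "HOL-Algebra.Complete_Lattice"
begin

section \<open>Simplicial complexes and their flats\<close>

definition simplicial_complex :: "'a set \<Rightarrow> 'a set set \<Rightarrow> bool" where
  "simplicial_complex V H \<longleftrightarrow>
     finite V \<and> V \<noteq> {} \<and> H \<subseteq> Pow V \<and> H \<noteq> {} \<and> (\<forall>X\<in>H. \<forall>Y. Y \<subseteq> X \<longrightarrow> Y \<in> H)"

definition flats :: "'a set \<Rightarrow> 'a set set \<Rightarrow> 'a set set" where
  "flats V H = {X. X \<subseteq> V \<and> (\<forall>I\<in>H. I \<subseteq> X \<longrightarrow> (\<forall>p\<in>V - X. I \<union> {p} \<in> H))}"

definition flat_lattice :: "'a set \<Rightarrow> 'a set set \<Rightarrow> 'a set gorder" where
  "flat_lattice V H = \<lparr>carrier = flats V H, eq = (=), le = (\<subseteq>)\<rparr>"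

section \<open>Boolean representability\<close>

text \<open>A chain with \<open>k\<close> steps is given by the values \<open>A 0, \<dots>, A k\<close> of a function on
  the natural numbers; the other values are irrelevant.\<close>

definition strict_chain_in :: "'a set set \<Rightarrow> nat \<Rightarrow> (nat \<Rightarrow> 'a set) \<Rightarrow> bool" where
  "strict_chain_in F k A \<longleftrightarrow> (\<forall>i\<le>k. A i \<in> F) \<and> (\<forall>i<k. A i \<subset> A (Suc i))"

definition transversal_of_differences :: "nat \<Rightarrow> (nat \<Rightarrow> 'a set) \<Rightarrow> 'a set \<Rightarrow> bool" where
  "transversal_of_differences k A X \<longleftrightarrow>
     (\<exists>x. bij_betw x {1..k} X \<and> (\<forall>i\<in>{1..k}. x i \<in> A i - A (i - 1)))"

definition boolean_representable :: "'a set \<Rightarrow> 'a set set \<Rightarrow> bool" where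
  "boolean_representable V H \<longleftrightarrow>
     (\<forall>X\<in>H. \<exists>k A. strict_chain_in (flats V H) k A \<and> transversal_of_differences k A X)"

section \<open>Atoms and atomistic lattices\<close>

definition covers :: "('a, 'b) gorder_scheme \<Rightarrow> 'a \<Rightarrow> 'a \<Rightarrow> bool" where
  "covers L y x \<longleftrightarrow> x \<in> carrier L \<and> y \<in> carrier L \<and> x \<sqsubset>\<^bsub>L\<^esub> y \<and>
     \<not> (\<exists>z\<in>carrier L. x \<sqsubset>\<^bsub>L\<^esub> z \<and> z \<sqsubset>\<^bsub>L\<^esub> y)"

definition atoms :: "('a, 'b) gorder_scheme \<Rightarrow> 'a set" where
  "atoms L = {a. covers L a \<bottom>\<^bsub>L\<^esub>}"

text \<open>The set of atoms joined may be empty; its join is then the bottom element.\<close>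

definition atomistic_lattice :: "('a, 'b) gorder_scheme \<Rightarrow> bool" where
  "atomistic_lattice L \<longleftrightarrow> lattice L \<and> finite (carrier L) \<and>
     (\<forall>x\<in>carrier L. \<exists>S\<subseteq>atoms L. least L x (Upper L S))"

section \<open>The flats form a finite lattice with intersection as meet\<close>

lemma flats_Int: "X \<inter> Y \<in> flats V H" if "X \<in> flats V H" "Y \<in> flats V H"
  using that unfolding flats_def by blast

lemma flats_Inter: "V \<inter> \<Inter> \<X> \<in> flats V H" if "\<X> \<subseteq> flats V H"
  using that unfolding flats_def by blast

lemma finite_flats: "finite (flats V H)" if "simplicial_complex V H"
  by (rule finite_subset[of _ "Pow V"]) (use that in \<open>auto simp: flats_def simplicial_complex_def\<close>)

lemma flat_lattice_simps [simp]:
  "carrier (flat_lattice V H) = flats V H"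
  "x \<sqsubseteq>\<^bsub>flat_lattice V H\<^esub> y \<longleftrightarrow> x \<subseteq> y"
  "x .=\<^bsub>flat_lattice V H\<^esub> y \<longleftrightarrow> x = y"
  "x \<sqsubset>\<^bsub>flat_lattice V H\<^esub> y \<longleftrightarrow> x \<subset> y"
  by (auto simp: flat_lattice_def lless_def)

lemma complete_lattice_flat_lattice: "complete_lattice (flat_lattice V H)"
proof -
  let ?L = "flat_lattice V H"
  interpret partial_order ?L
    by unfold_locales (auto simp: flat_lattice_def)
  show ?thesis
  proof (rule complete_latticeI)
    fix A assume "A \<subseteq> carrier ?L"
    then have A: "A \<subseteq> flats V H" by simp
    have sub: "X \<subseteq> V" if "X \<in> flats V H" for X
      using that by (simp add: flats_def)
    have up: "Upper ?L A = {u \<in> flats V H. \<forall>x\<in>A. x \<subseteq> u}"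
      using A by (auto simp: Upper_def)
    have lo: "Lower ?L A = {l \<in> flats V H. \<forall>x\<in>A. l \<subseteq> x}"
      using A by (auto simp: Lower_def)
    have "V \<inter> \<Inter> (Upper ?L A) \<in> flats V H"
      by (rule flats_Inter) (simp add: up)
    moreover have "\<forall>x\<in>A. x \<subseteq> V \<inter> \<Inter> (Upper ?L A)"
      using A sub unfolding up by blast
    ultimately have "least ?L (V \<inter> \<Inter> (Upper ?L A)) (Upper ?L A)"
      unfolding least_def up flat_lattice_simps by blast
    then show "\<exists>s. least ?L s (Upper ?L A)" by blast
    have "V \<inter> \<Inter> A \<in> flats V H"
      using A by (rule flats_Inter)
    then have "greatest ?L (V \<inter> \<Inter> A) (Lower ?L A)"
      using sub unfolding greatest_def lo flat_lattice_simps by blast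
    then show "\<exists>s. greatest ?L s (Lower ?L A)" by blast
  qed
qed

lemma lattice_flat_lattice: "lattice (flat_lattice V H)"
proof -
  interpret complete_lattice "flat_lattice V H" by (rule complete_lattice_flat_lattice)
  show ?thesis by (rule lattice_axioms)
qed

lemma meet_flat_lattice:
  assumes "X \<in> flats V H" "Y \<in> flats V H"
  shows "X \<sqinter>\<^bsub>flat_lattice V H\<^esub> Y = X \<inter> Y"
proof -
  interpret lattice "flat_lattice V H" by (rule lattice_flat_lattice)
  have "greatest (flat_lattice V H) (X \<inter> Y) (Lower (flat_lattice V H) {X, Y})"
    using assms flats_Int[OF assms] by (auto simp: greatest_def Lower_def)
  then show ?thesis
    unfolding meet_def inf_def by (metis (mono_tags, lifting) greatest_unique someI)
qed

lemma bottom_flat_lattice: "\<bottom>\<^bsub>flat_lattice V H\<^esub> = \<Inter> (flats V H)"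
proof -
  let ?L = "flat_lattice V H"
  interpret complete_lattice ?L by (rule complete_lattice_flat_lattice)
  have "V \<in> flats V H" by (auto simp: flats_def)
  then have "V \<inter> \<Inter> (flats V H) = \<Inter> (flats V H)" by blast
  then have "least ?L (\<Inter> (flats V H)) (carrier ?L)"
    using flats_Inter[of "flats V H" V H] by (auto simp: least_def)
  then show ?thesis
    unfolding bottom_def by (metis (mono_tags, lifting) least_unique someI)
qed

end

theory Submission
  imports Defs
begin

text \<open>The atoms of the lattice of flats are the classes \<open>F q\<close> consisting of a vertex \<open>q\<close> with
  \<open>{q} \<in> H\<close> together with all \<open>p\<close> such that \<open>{p, q} \<notin> H\<close>. Boolean representability yields,
  for every edge of \<open>H\<close>, a flat containing exactly one of its ends; hence \<open>F q\<close> contains no edge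
  and is itself a flat. Any flat that contains \<open>q\<close> contains \<open>F q\<close>, so a flat \<open>X\<close> is the join of
  the \<open>F q\<close> with \<open>q \<in> X\<close>; the vertices \<open>p\<close> with \<open>{p} \<notin> H\<close> lie in every flat.\<close>

text \<open>This is the set \<open>F q\<close> of the overview. The comprehension alone would omit
  \<open>q\<close> when \<open>{q} \<in> H\<close>, since \<open>{q, q} = {q}\<close>; hence the
  \<open>insert\<close>.\<close>

definition parallel_class :: "'a set \<Rightarrow> 'a set set \<Rightarrow> 'a \<Rightarrow> 'a set" where
  "parallel_class V H q = insert q {p \<in> V. {p, q} \<notin> H}"

lemma flat_insertD:
  assumes "A \<in> flats V H" "{p} \<in> H" "p \<in> A" "q \<in> V" "q \<notin> A"
  shows "{p, q} \<in> H"
proof -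
  have "{p} \<union> {q} \<in> H" using assms unfolding flats_def by blast
  then show ?thesis by (simp add: insert_commute)
qed

lemma parallel_class_subset_flat:
  assumes "A \<in> flats V H" "{q} \<in> H" "q \<in> A"
  shows "parallel_class V H q \<subseteq> A"
  using flat_insertD[OF assms] assms(3) by (auto simp: parallel_class_def insert_commute)

text \<open>An edge is a transversal of a chain with two steps; its middle flat \<open>A 1\<close>
  contains \<open>x 1\<close> but not \<open>x 2\<close>.\<close>

lemma flat_separates_edge:
  assumes "boolean_representable V H" "{p, q} \<in> H" "p \<noteq> q"
  obtains A where "A \<in> flats V H" "p \<in> A \<longleftrightarrow> q \<notin> A"
proof -
  obtain k A x where ch: "strict_chain_in (flats V H) k A"
    and b: "bij_betw x {1..k} {p, q}" and x: "\<forall>i\<in>{1..k}. x i \<in> A i - A (i - 1)"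
    using assms unfolding boolean_representable_def transversal_of_differences_def by metis
  have "k = 2"
    using bij_betw_same_card[OF b] assms(3) by simp
  then have "{1..k} = {1, 2}" by auto
  then have "{x 1, x 2} = {p, q}" "x 1 \<in> A 1" "x 2 \<notin> A 1"
    using b x by (auto simp: bij_betw_def)
  moreover have "A 1 \<in> flats V H"
    using ch \<open>k = 2\<close> by (simp add: strict_chain_in_def)
  ultimately show thesis
    using that by (metis doubleton_eq_iff)
qed

text \<open>The flat condition for the empty face would put \<open>{p}\<close> into \<open>H\<close>
  if \<open>p\<close> were outside \<open>A\<close>.\<close>

lemma mem_flat_if_not_face:
  assumes "simplicial_complex V H" "A \<in> flats V H" "p \<in> V" "{p} \<notin> H"
  shows "p \<in> A"
proof -
  have "{} \<in> H" using assms(1) unfolding simplicial_complex_def by blast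
  then show ?thesis using assms unfolding flats_def by force
qed

context
  fixes V :: "'a set" and H :: "'a set set"
  assumes sc: "simplicial_complex V H" and br: "boolean_representable V H"
begin

lemma face_subset: "X \<in> H \<Longrightarrow> Y \<subseteq> X \<Longrightarrow> Y \<in> H"
  using sc unfolding simplicial_complex_def by blast

lemma face_vertices: "X \<in> H \<Longrightarrow> p \<in> X \<Longrightarrow> p \<in> V"
  using sc unfolding simplicial_complex_def by blast

text \<open>A flat separating an edge inside the class either contains \<open>q\<close>, hence the
  whole class, or misses \<open>q\<close>, and then its end of the edge would be joined to
  \<open>q\<close>.\<close>

lemma no_edge_in_parallel_class:
  assumes "{q} \<in> H" "p \<in> parallel_class V H q" "r \<in> parallel_class V H q" "{p, r} \<in> H"
  shows "p = r"
proof (rule ccontr)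
  \<comment> \<open>The ends are ordered here because the separating flat may contain either of
    them.\<close>
  have *: False if "A \<in> flats V H" "a \<in> A" "b \<notin> A" "{a, b} \<in> H"
    "a \<in> parallel_class V H q" "b \<in> parallel_class V H q" for A a b
  proof (cases "q \<in> A")
    case True
    then show False using parallel_class_subset_flat[OF that(1) assms(1)] that by blast
  next
    case False
    moreover have "{a} \<in> H" using face_subset[OF that(4)] by blast
    moreover have "q \<in> V" using face_vertices[OF assms(1)] by simp
    ultimately have "{a, q} \<in> H" using flat_insertD that by metis
    then show False using that False by (auto simp: parallel_class_def)
  qed
  assume "p \<noteq> r"
  then obtain A where "A \<in> flats V H" "p \<in> A \<longleftrightarrow> r \<notin> A"
    using flat_separates_edge[OF br assms(4)] by blast
  then show False
    using *[of A p r] *[of A r p] assms by (auto simp: insert_commute)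
qed

text \<open>A flat separating the edge \<open>{q, r}\<close> also separates \<open>p\<close> from
  \<open>r\<close>, because no flat separates \<open>p\<close> from \<open>q\<close>; the flat
  condition then gives the edge.\<close>

lemma parallel_class_edge_outside:
  assumes "{q} \<in> H" "p \<in> parallel_class V H q" "{p} \<in> H"
    "r \<in> V" "r \<notin> parallel_class V H q"
  shows "{p, r} \<in> H"
proof -
  have qr: "{q, r} \<in> H" "q \<noteq> r"
    using assms by (auto simp: parallel_class_def insert_commute)
  have r: "{r} \<in> H" using face_subset[OF qr(1)] by blast
  have p: "p \<in> V" and q: "q \<in> V"
    using face_vertices[OF assms(3)] face_vertices[OF assms(1)] by auto
  have par: "p = q \<or> {p, q} \<notin> H"
    using assms(2) by (auto simp: parallel_class_def)
  obtain A where A: "A \<in> flats V H" "q \<in> A \<longleftrightarrow> r \<notin> A"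
    using flat_separates_edge[OF br qr] by blast
  show ?thesis
  proof (cases "q \<in> A")
    case True
    then have "p \<in> A"
      using parallel_class_subset_flat[OF A(1) assms(1)] assms(2) by blast
    then show ?thesis using flat_insertD[OF A(1) assms(3)] assms(4) A True by blast
  next
    case False
    \<comment> \<open>If \<open>p\<close> were in \<open>A\<close>, then \<open>p \<noteq> q\<close>
      and the flat condition would make \<open>{p, q}\<close> an edge.\<close>
    then have "p \<notin> A" using flat_insertD[OF A(1) assms(3)] q par by blast
    then show ?thesis
      using flat_insertD[OF A(1) r _ p] A False by (simp add: insert_commute)
  qed
qed

text \<open>A face inside the class has at most one vertex, so the flat condition concerns only the
  empty face and singletons.\<close>

lemma parallel_class_flat:
  assumes "{q} \<in> H"
  shows "parallel_class V H q \<in> flats V H"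
proof -
  have "I \<union> {r} \<in> H"
    if I: "I \<in> H" "I \<subseteq> parallel_class V H q" and r: "r \<in> V - parallel_class V H q" for I r
  proof (cases "I = {}")
    case True
    have "{q, r} \<in> H"
      using parallel_class_edge_outside[OF assms _ assms] r by (auto simp: parallel_class_def)
    then show ?thesis using face_subset[of "{q, r}" "{r}"] True by simp
  next
    case False
    then obtain p where p: "p \<in> I" by blast
    have "p' = p" if "p' \<in> I" for p'
      using no_edge_in_parallel_class[OF assms, of p' p] face_subset[OF I(1), of "{p', p}"] I p that
      by blast
    then have "I = {p}" using p by blast
    then show ?thesis
      using parallel_class_edge_outside[OF assms, of p r] I r by (simp add: insert_commute)
  qed
  moreover have "parallel_class V H q \<subseteq> V"
    using face_vertices[OF assms] by (auto simp: parallel_class_def)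
  ultimately show ?thesis unfolding flats_def by blast
qed

lemma bottom_flat_lattice_eq: "\<bottom>\<^bsub>flat_lattice V H\<^esub> = {p \<in> V. {p} \<notin> H}"
proof -
  let ?Z = "{p \<in> V. {p} \<notin> H}"
  have "I \<union> {p} \<in> H" if "I \<in> H" "I \<subseteq> ?Z" "p \<in> V - ?Z" for I p
  proof -
    \<comment> \<open>Any vertex of \<open>I\<close> would be a singleton face, which the set
      \<open>?Z\<close> excludes.\<close>
    have "I = {}" using that face_subset[OF that(1)] by blast
    then show ?thesis using that by simp
  qed
  then have "?Z \<in> flats V H" unfolding flats_def by blast
  moreover have "?Z \<subseteq> A" if "A \<in> flats V H" for A
    using mem_flat_if_not_face[OF sc that] by blast
  ultimately show ?thesis unfolding bottom_flat_lattice by blast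
qed

lemma bottom_is_flat: "\<bottom>\<^bsub>flat_lattice V H\<^esub> \<in> flats V H"
proof -
  interpret complete_lattice "flat_lattice V H" by (rule complete_lattice_flat_lattice)
  show ?thesis using bottom_closed by simp
qed

text \<open>A flat strictly between the bottom and the class would contain some \<open>y\<close>
  with \<open>{y} \<in> H\<close> and miss some \<open>z\<close> of the class, making
  \<open>{y, z}\<close> an edge inside the class.\<close>

lemma parallel_class_atom:
  assumes "{q} \<in> H"
  shows "parallel_class V H q \<in> atoms (flat_lattice V H)"
proof -
  let ?B = "\<bottom>\<^bsub>flat_lattice V H\<^esub>"
  have F: "parallel_class V H q \<in> flats V H" by (rule parallel_class_flat[OF assms])
  have "?B \<subseteq> parallel_class V H q"
    using F unfolding bottom_flat_lattice by blast
  moreover have "q \<notin> ?B" using assms by (simp add: bottom_flat_lattice_eq)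
  moreover have "q \<in> parallel_class V H q" by (simp add: parallel_class_def)
  ultimately have "?B \<subset> parallel_class V H q" by blast
  moreover have False if Y: "Y \<in> flats V H" "?B \<subset> Y" "Y \<subset> parallel_class V H q" for Y
  proof -
    obtain y where y: "y \<in> Y" "y \<notin> ?B" using Y by blast
    obtain z where z: "z \<in> parallel_class V H q" "z \<notin> Y" using Y by blast
    have "Y \<subseteq> V" "parallel_class V H q \<subseteq> V" using Y F by (auto simp: flats_def)
    then have "y \<in> V" "z \<in> V" using y z by auto
    then have "{y} \<in> H" using y by (simp add: bottom_flat_lattice_eq)
    then have "{y, z} \<in> H" using flat_insertD[OF Y(1)] y z \<open>z \<in> V\<close> by blast
    then have "y = z" using no_edge_in_parallel_class[OF assms] y z Y by blast
    then show False using y z by blast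
  qed
  ultimately show ?thesis
    using F bottom_is_flat by (auto simp: atoms_def covers_def)
qed

text \<open>For \<open>X\<close> the bottom flat the index set is empty, so this covers the empty
  join as well.\<close>

lemma flat_is_join_of_parallel_classes:
  assumes "X \<in> flats V H"
  shows "least (flat_lattice V H) X
    (Upper (flat_lattice V H) (parallel_class V H ` {q \<in> X. {q} \<in> H}))"
proof -
  let ?S = "parallel_class V H ` {q \<in> X. {q} \<in> H}"
  have S: "?S \<subseteq> flats V H" using parallel_class_flat by blast
  then have up: "Upper (flat_lattice V H) ?S = {u \<in> flats V H. \<forall>s\<in>?S. s \<subseteq> u}"
    by (auto simp: Upper_def)
  have "s \<subseteq> X" if "s \<in> ?S" for s
    using that parallel_class_subset_flat[OF assms] by blast
  moreover have "X \<subseteq> u" if u: "u \<in> flats V H" "\<forall>s\<in>?S. s \<subseteq> u" for u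
  proof
    fix p assume p: "p \<in> X"
    show "p \<in> u"
    proof (cases "{p} \<in> H")
      case True
      then have "parallel_class V H p \<subseteq> u" using u p by blast
      then show ?thesis by (auto simp: parallel_class_def)
    next
      case False
      have "p \<in> V" using assms p by (auto simp: flats_def)
      then show ?thesis using mem_flat_if_not_face[OF sc u(1)] False by blast
    qed
  qed
  ultimately show ?thesis
    using assms unfolding least_def up flat_lattice_simps by blast
qed

lemma atomistic_flat_lattice: "atomistic_lattice (flat_lattice V H)"
proof -
  have "\<exists>S\<subseteq>atoms (flat_lattice V H). least (flat_lattice V H) X (Upper (flat_lattice V H) S)"
    if "X \<in> flats V H" for X
    using flat_is_join_of_parallel_classes[OF that] parallel_class_atom
    by (intro exI[of _ "parallel_class V H ` {q \<in> X. {q} \<in> H}"]) blast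
  then show ?thesis
    unfolding atomistic_lattice_def
    using lattice_flat_lattice finite_flats[OF sc] by simp
qed

lemma Union_atoms_flat_lattice:
  assumes "\<forall>p\<in>V. {p} \<in> H"
  shows "V = \<Union> (atoms (flat_lattice V H))"
proof
  show "V \<subseteq> \<Union> (atoms (flat_lattice V H))"
    \<comment> \<open>Each vertex lies in its own class, which is an atom.\<close>
    using parallel_class_atom assms by (auto simp: parallel_class_def)
  show "\<Union> (atoms (flat_lattice V H)) \<subseteq> V"
    by (auto simp: atoms_def covers_def flats_def)
qed

end

theorem theorem4p3:
  fixes V :: "'a set" and H :: "'a set set"
  assumes "simplicial_complex V H" and "boolean_representable V H"
  shows "((\<forall>p\<in>V. {p} \<in> H) \<longrightarrow> V = \<Union> (atoms (flat_lattice V H)))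
       \<and> atomistic_lattice (flat_lattice V H)"
  using Union_atoms_flat_lattice[OF assms] atomistic_flat_lattice[OF assms] by blast

end
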